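(* Let $\Sigma$ be a finite set, let $p\in\Delta(\Sigma)$ have full support, let $g\in\mathbb{R}^{\Sigma}$, and let $\varepsilon>0$. Consider the optimization problem $$\max_{q\in\Delta(\Sigma)}\ g\cdot q\quad\text{subject to}\quad\sum_{u\in\Sigma}\frac{(q_u-p_u)^2}{p_u}\le\varepsilon .$$ Then there exist $\delta\ge0$ and $\mu\in\mathbb{R}$ such that an optimal solution $q^*$ is given by $$\forall u\in\Sigma,\qquad q^*_u=p_u\,[1+\delta(g_u+\mu)]_+ ,$$ where $\mu$ is such that $\sum_{u\in\Sigma}q^*_u=1$, and $\delta$ is such that $\sum_{u\in\Sigma}\frac{(q^*_u-p_u)^2}{p_u}=\varepsilon$ if this equality is achievable by some $\delta\ge0$ (with its corresponding $\mu$); otherwise, the greedy solution is feasible, i.e. some distribution in $\Delta(\Sigma)$ supported on $\arg\max_{u\in\Sigma}g_u$ satisfies the constraint.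
   Context: $\Delta(\Sigma)$ is the set of probability vectors $q=(q_u)_{u\in\Sigma}$ on the finite set $\Sigma$; full support means $p_u>0$ for all $u$. The dot product is $g\cdot q=\sum_{u\in\Sigma}g_uq_u$. $[x]_+:=\max(0,x)$. *)

theory Defs
  imports "HOL-Analysis.Analysis"
begin

text \<open>
  A vector in \<open>\<real>\<^sup>\<Sigma>\<close> is an element of \<open>real ^ 'u\<close>, the finite index type \<open>'u\<close>
  playing the role of \<open>\<Sigma>\<close>. Types are nonempty, but an empty \<open>\<Sigma>\<close> carries no
  probability vector, so no generality is lost.
\<close>

definition prob_simplex :: "(real ^ 'u::finite) set" where
  "prob_simplex = {q. (\<forall>u. 0 \<le> q $ u) \<and> (\<Sum>u\<in>UNIV. q $ u) = 1}"

definition chi_square :: "real ^ 'u::finite \<Rightarrow> real ^ 'u \<Rightarrow> real" where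
  "chi_square p q = (\<Sum>u\<in>UNIV. (q $ u - p $ u)\<^sup>2 / p $ u)"

definition feasible :: "real ^ 'u::finite \<Rightarrow> real \<Rightarrow> (real ^ 'u) set" where
  "feasible p \<epsilon> = {q \<in> prob_simplex. chi_square p q \<le> \<epsilon>}"

definition optimal :: "real ^ 'u::finite \<Rightarrow> real ^ 'u \<Rightarrow> real \<Rightarrow> real ^ 'u \<Rightarrow> bool" where
  "optimal p g \<epsilon> q \<longleftrightarrow> is_arg_max (\<lambda>q. g \<bullet> q) (\<lambda>q. q \<in> feasible p \<epsilon>) q"

definition pos_part :: "real \<Rightarrow> real" where
  "pos_part x = max 0 x"

text \<open>The sum of the coordinates is 1 only for suitable \<open>\<mu>\<close>; the definition does not normalise.\<close>

definition tilt :: "real ^ 'u::finite \<Rightarrow> real ^ 'u \<Rightarrow> real \<Rightarrow> real \<Rightarrow> real ^ 'u" where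
  "tilt p g \<delta> \<mu> = (\<chi> u. p $ u * pos_part (1 + \<delta> * (g $ u + \<mu>)))"

definition argmax_set :: "real ^ 'u::finite \<Rightarrow> 'u set" where
  "argmax_set g = {u. is_arg_max (\<lambda>v. g $ v) (\<lambda>_. True) u}"

end

(*
  A normalised tilt is the point of the simplex closest to the vector p (1 + delta (g + mu)) in
  the 1/p-weighted Euclidean norm.  The corresponding variational inequality gives
  2 delta g.(q - r) <= chi_square p q - chi_square p r for the tilt r, so a tilt with delta > 0 whose
  divergence is exactly epsilon is optimal.

  Rather than solving for mu as a function of delta, the tilts with delta > 0 are parametrised by
  the level t at which the positive part vanishes: the tilt is proportional to p [g - t]_+, where t
  ranges below max g.  Its divergence is continuous in t and tends to 0 as t goes to minus infinity;
  for t between the two largest values of g, the tilt is p conditioned on the argmax set.  If the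
  latter violates the constraint, the intermediate value theorem yields a tilt with divergence
  epsilon; otherwise it is itself optimal.
*)
theory Submission
  imports Defs
begin

section \<open>Divergence inequality for tilts and optimality of tight ones\<close>

lemma chi_square_eq_weighted_norm:
  assumes "p \<in> prob_simplex" "\<forall>u. p $ u > 0" "(\<Sum>u\<in>UNIV. q $ u) = 1"
  shows "chi_square p q = (\<Sum>u\<in>UNIV. (q $ u)\<^sup>2 / p $ u) - 1"
proof -
  have "(q $ u - p $ u)\<^sup>2 / p $ u = (q $ u)\<^sup>2 / p $ u - 2 * q $ u + p $ u" for u
  proof -
    have "p $ u \<noteq> 0" using assms(2) by (metis less_irrefl)
    then show ?thesis by (simp add: field_simps power2_eq_square)
  qed
  then have "chi_square p q = (\<Sum>u\<in>UNIV. (q $ u)\<^sup>2 / p $ u) - 2 * (\<Sum>u\<in>UNIV. q $ u) + (\<Sum>u\<in>UNIV. p $ u)"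
    by (simp add: chi_square_def sum.distrib sum_subtractf sum_distrib_left)
  with assms show ?thesis by (simp add: prob_simplex_def)
qed

lemma tilt_in_prob_simplex:
  assumes "\<forall>u. p $ u > 0" "(\<Sum>u\<in>UNIV. tilt p g \<delta> \<mu> $ u) = 1"
  shows "tilt p g \<delta> \<mu> \<in> prob_simplex"
  using assms by (simp add: prob_simplex_def tilt_def pos_part_def less_imp_le)

text \<open>Coordinatewise, the convex map x^2 / \<open>p $ u\<close> lies above its tangent at the
  tilt, whose slope is twice the positive part; complementarity then lets the untruncated affine
  expression replace the positive part.\<close>

lemma tilt_variational_inequality:
  assumes p: "p \<in> prob_simplex" "\<forall>u. p $ u > 0"
    and norm: "(\<Sum>u\<in>UNIV. tilt p g \<delta> \<mu> $ u) = 1"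
    and q: "q \<in> prob_simplex"
  shows "2 * \<delta> * (g \<bullet> q - g \<bullet> tilt p g \<delta> \<mu>) \<le> chi_square p q - chi_square p (tilt p g \<delta> \<mu>)"
proof -
  define r where "r = tilt p g \<delta> \<mu>"
  have sums: "(\<Sum>u\<in>UNIV. q $ u) = 1" "(\<Sum>u\<in>UNIV. r $ u) = 1"
    using q norm by (auto simp: prob_simplex_def r_def)
  \<comment> \<open>The term with factor \<open>1 + \<delta> * \<mu>\<close> cancels after
    summation, since \<open>q\<close> and \<open>r\<close> have the same total mass.\<close>
  have pointwise: "2 * \<delta> * (g $ u * q $ u - g $ u * r $ u) + 2 * (1 + \<delta> * \<mu>) * (q $ u - r $ u)
      \<le> (q $ u)\<^sup>2 / p $ u - (r $ u)\<^sup>2 / p $ u" for u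
  proof -
    define a where "a = 1 + \<delta> * (g $ u + \<mu>)"
    define k where "k = pos_part a"
    have pu: "p $ u > 0" and qu: "q $ u \<ge> 0"
      using p q by (auto simp: prob_simplex_def)
    have ru: "r $ u = p $ u * k"
      by (simp add: r_def tilt_def a_def k_def)
    \<comment> \<open>Either \<open>a\<close> is nonnegative and equals \<open>k\<close>, or
      \<open>k\<close> and \<open>r $ u\<close> vanish while \<open>q $ u\<close> is
      nonnegative.\<close>
    have complementarity: "(q $ u - r $ u) * (a - k) \<le> 0"
      using qu by (cases "a \<ge> 0") (auto simp: ru k_def pos_part_def mult_nonneg_nonpos)
    have "0 \<le> (q $ u - r $ u)\<^sup>2 / p $ u" using pu by simp
    also have "\<dots> = (q $ u)\<^sup>2 / p $ u - (r $ u)\<^sup>2 / p $ u - 2 * (q $ u - r $ u) * k"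
      using pu by (simp add: ru field_simps power2_eq_square)
    finally have "2 * (q $ u - r $ u) * k \<le> (q $ u)\<^sup>2 / p $ u - (r $ u)\<^sup>2 / p $ u" by simp
    moreover have "2 * \<delta> * (g $ u * q $ u - g $ u * r $ u) + 2 * (1 + \<delta> * \<mu>) * (q $ u - r $ u)
        = 2 * (q $ u - r $ u) * a"
      by (simp add: a_def algebra_simps)
    ultimately show ?thesis using complementarity by (simp add: algebra_simps)
  qed
  have "(\<Sum>u\<in>UNIV. 2 * \<delta> * (g $ u * q $ u - g $ u * r $ u) + 2 * (1 + \<delta> * \<mu>) * (q $ u - r $ u))
      \<le> (\<Sum>u\<in>UNIV. (q $ u)\<^sup>2 / p $ u - (r $ u)\<^sup>2 / p $ u)"
    by (intro sum_mono pointwise)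
  then have "2 * \<delta> * (g \<bullet> q - g \<bullet> r) + 2 * (1 + \<delta> * \<mu>) * ((\<Sum>u\<in>UNIV. q $ u) - (\<Sum>u\<in>UNIV. r $ u))
      \<le> (\<Sum>u\<in>UNIV. (q $ u)\<^sup>2 / p $ u) - (\<Sum>u\<in>UNIV. (r $ u)\<^sup>2 / p $ u)"
    by (simp only: sum.distrib sum_subtractf sum_distrib_left[symmetric] inner_vec_def inner_real_def)
  then show ?thesis
    using sums chi_square_eq_weighted_norm[OF p sums(1)] chi_square_eq_weighted_norm[OF p sums(2)]
    by (simp add: r_def)
qed

lemma optimalI:
  assumes "q \<in> feasible p \<epsilon>" "\<And>q'. q' \<in> feasible p \<epsilon> \<Longrightarrow> g \<bullet> q' \<le> g \<bullet> q"
  shows "optimal p g \<epsilon> q"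
  using assms by (auto simp: optimal_def is_arg_max_def not_less)

lemma tilt_optimal_if_tight:
  assumes p: "p \<in> prob_simplex" "\<forall>u. p $ u > 0" and "\<epsilon> > 0" and "\<delta> \<ge> 0"
    and norm: "(\<Sum>u\<in>UNIV. tilt p g \<delta> \<mu> $ u) = 1"
    and tight: "chi_square p (tilt p g \<delta> \<mu>) = \<epsilon>"
  shows "optimal p g \<epsilon> (tilt p g \<delta> \<mu>)"
proof (rule optimalI)
  show "tilt p g \<delta> \<mu> \<in> feasible p \<epsilon>"
    using tilt_in_prob_simplex[OF p(2) norm] tight by (simp add: feasible_def)
  \<comment> \<open>At \<delta> = 0 the variational inequality says nothing about \<open>g\<close>;
    tightness excludes this case, because the tilt would be \<open>p\<close>, with divergence
    0.\<close>
  have "\<delta> \<noteq> 0"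
  proof
    assume "\<delta> = 0"
    then have "tilt p g \<delta> \<mu> = p" by (simp add: tilt_def pos_part_def vec_eq_iff)
    with tight \<open>\<epsilon> > 0\<close> show False by (simp add: chi_square_def)
  qed
  with \<open>\<delta> \<ge> 0\<close> have "\<delta> > 0" by simp
  fix q assume "q \<in> feasible p \<epsilon>"
  then have "q \<in> prob_simplex" "chi_square p q \<le> \<epsilon>" by (auto simp: feasible_def)
  with tilt_variational_inequality[OF p norm, of q] tight
  have "2 * \<delta> * (g \<bullet> q - g \<bullet> tilt p g \<delta> \<mu>) \<le> 0" by simp
  with \<open>\<delta> > 0\<close> show "g \<bullet> q \<le> g \<bullet> tilt p g \<delta> \<mu>"
    by (simp add: mult_le_0_iff)
qed

section \<open>Tilts parametrised by their level\<close>

definition excess :: "real ^ 'u::finite \<Rightarrow> real ^ 'u \<Rightarrow> real \<Rightarrow> real" where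
  "excess p g t = (\<Sum>u\<in>UNIV. p $ u * pos_part (g $ u - t))"

text \<open>Dividing by \<open>excess\<close> normalises without solving for \<mu>. At levels not
  below the maximum of \<open>g\<close> this is 0 / 0, hence the zero vector, so the lemmas keep
  \<open>t\<close> below some coordinate.\<close>

definition level_tilt :: "real ^ 'u::finite \<Rightarrow> real ^ 'u \<Rightarrow> real \<Rightarrow> real ^ 'u" where
  "level_tilt p g t = (\<chi> u. p $ u * pos_part (g $ u - t) / excess p g t)"

lemma excess_pos:
  assumes "\<forall>u. p $ u > 0" "t < g $ v"
  shows "excess p g t > 0"
  unfolding excess_def
  by (rule sum_pos2[of _ v]) (use assms in \<open>auto simp: pos_part_def less_imp_le\<close>)

lemma sum_level_tilt:
  assumes "\<forall>u. p $ u > 0" "t < g $ v"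
  shows "(\<Sum>u\<in>UNIV. level_tilt p g t $ u) = 1"
  using excess_pos[of p t g v, OF assms]
  by (simp add: level_tilt_def excess_def sum_divide_distrib[symmetric])

text \<open>These parameters turn 1 + \<delta> (g + \<mu>) into (g - t) / excess, and the positive
  factor 1 / excess passes through the positive part.\<close>

lemma level_tilt_eq_tilt:
  assumes "\<forall>u. p $ u > 0" "t < g $ v"
  shows "level_tilt p g t = tilt p g (1 / excess p g t) (- t - excess p g t)"
proof -
  have "pos_part (g $ u - t) / excess p g t
      = pos_part (1 + 1 / excess p g t * (g $ u + (- t - excess p g t)))" for u
  proof -
    have e: "excess p g t > 0" using assms by (rule excess_pos)
    then have "1 + 1 / excess p g t * (g $ u + (- t - excess p g t)) = (g $ u - t) / excess p g t"
      by (simp add: field_simps)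
    with e show ?thesis by (auto simp: pos_part_def max_def divide_le_0_iff zero_le_divide_iff)
  qed
  then show ?thesis
    by (simp add: level_tilt_def tilt_def vec_eq_iff times_divide_eq_right[symmetric]
        del: times_divide_eq_right)
qed

lemma continuous_on_chi_square_level_tilt:
  assumes "\<forall>u. p $ u > 0" "\<forall>t\<in>T. t < g $ v"
  shows "continuous_on T (\<lambda>t. chi_square p (level_tilt p g t))"
proof -
  have "continuous_on T (excess p g)"
    unfolding excess_def pos_part_def by (intro continuous_intros)
  moreover have "excess p g t \<noteq> 0" if "t \<in> T" for t
    using excess_pos[of p t g v] assms that by fastforce
  moreover have "p $ u \<noteq> 0" for u using assms(1) by (metis less_irrefl)
  ultimately show ?thesis
    unfolding chi_square_def level_tilt_def pos_part_def
    by (simp, intro continuous_intros) auto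
qed

text \<open>Below all values of \<open>g\<close> nothing is truncated, so the tilt is affine in
  \<open>g\<close>. The numerator is the variance of \<open>g\<close> under
  \<open>p\<close>.\<close>

lemma chi_square_level_tilt_low:
  assumes p: "p \<in> prob_simplex" "\<forall>u. p $ u > 0" and low: "\<forall>u. t < g $ u"
  shows "chi_square p (level_tilt p g t)
    = (\<Sum>u\<in>UNIV. p $ u * (g $ u - g \<bullet> p)\<^sup>2) / (g \<bullet> p - t)\<^sup>2"
proof -
  have [simp]: "pos_part (g $ u - t) = g $ u - t" for u
    using low by (simp add: pos_part_def max_def less_imp_le)
  have "excess p g t = (\<Sum>u\<in>UNIV. g $ u * p $ u) - t * (\<Sum>u\<in>UNIV. p $ u)"
    by (simp add: excess_def right_diff_distrib sum_subtractf sum_distrib_left mult.commute)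
  then have ex: "excess p g t = g \<bullet> p - t"
    using p by (simp add: inner_vec_def prob_simplex_def)
  have pos: "g \<bullet> p - t > 0"
    \<comment> \<open>Any coordinate serves as witness, as \<open>t\<close> lies below all of
      them.\<close>
    using excess_pos[of p t g undefined] p(2) low ex by simp
  have "(level_tilt p g t $ u - p $ u)\<^sup>2 / p $ u
      = p $ u * (g $ u - g \<bullet> p)\<^sup>2 / (g \<bullet> p - t)\<^sup>2" for u
  proof -
    have pu: "p $ u > 0" using p by simp
    have "level_tilt p g t $ u - p $ u = p $ u * ((g $ u - g \<bullet> p) / (g \<bullet> p - t))"
      using pos by (simp add: level_tilt_def ex field_simps)
    then show ?thesis
      using pu by (simp add: power_mult_distrib power_divide power2_eq_square[of "p $ u"])
  qed
  then show ?thesis by (simp add: chi_square_def sum_divide_distrib)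
qed

text \<open>The divergence is a fixed variance over a squared gap that grows as the level decreases.
  The bound \<open>s\<close> makes the level usable as a left endpoint for the intermediate value
  theorem.\<close>

lemma exists_level_tilt_feasible:
  assumes p: "p \<in> prob_simplex" "\<forall>u. p $ u > 0" and "\<epsilon> > 0"
  shows "\<exists>t\<le>s. chi_square p (level_tilt p g t) \<le> \<epsilon>"
proof -
  define V where "V = (\<Sum>u\<in>UNIV. p $ u * (g $ u - g \<bullet> p)\<^sup>2)"
  \<comment> \<open>The second bound puts \<open>t\<close> below every coordinate of
    \<open>g\<close>; the third makes the gap at least 1 and at least \<open>V / \<epsilon>\<close>,
    so its square is also at least \<open>V / \<epsilon>\<close>.\<close>
  define t where "t = min s (min (- norm g - 1) (g \<bullet> p - (1 + V / \<epsilon>)))"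
  have "t \<le> - norm g - 1" by (simp add: t_def)
  then have "t < g $ u" for u
    using component_le_norm_cart[of g u] by linarith
  then have chi: "chi_square p (level_tilt p g t) = V / (g \<bullet> p - t)\<^sup>2"
    using p by (simp add: chi_square_level_tilt_low V_def)
  have V: "V / \<epsilon> \<ge> 0"
    using p \<open>\<epsilon> > 0\<close> by (auto simp: V_def less_imp_le intro!: divide_nonneg_pos sum_nonneg)
  have gap: "g \<bullet> p - t \<ge> 1 + V / \<epsilon>" by (simp add: t_def)
  then have "V / \<epsilon> \<le> (g \<bullet> p - t) * 1" by simp
  also have "\<dots> \<le> (g \<bullet> p - t)\<^sup>2"
    unfolding power2_eq_square using gap V by (intro mult_left_mono) auto
  finally have "V \<le> \<epsilon> * (g \<bullet> p - t)\<^sup>2"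
    using \<open>\<epsilon> > 0\<close> by (simp add: field_simps)
  moreover have "(g \<bullet> p - t)\<^sup>2 > 0" using gap V by (intro zero_less_power) linarith
  ultimately have "V / (g \<bullet> p - t)\<^sup>2 \<le> \<epsilon>" by (simp only: pos_divide_le_eq)
  moreover have "t \<le> s" by (simp add: t_def)
  ultimately show ?thesis using chi by auto
qed

text \<open>A level between the two largest values of \<open>g\<close> truncates exactly the
  coordinates outside the argmax set and leaves a nonzero normaliser.\<close>

lemma exists_separating_level:
  fixes g :: "real ^ 'u::finite"
  obtains t v where "\<And>u. g $ u \<le> g $ v" "t < g $ v" "\<And>u. t < g $ u \<Longrightarrow> u \<in> argmax_set g"
proof -
  define M where "M = Max (range (($) g))"
  have "M \<in> range (($) g)" unfolding M_def by (intro Max_in) auto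
  then obtain v where v: "M = g $ v" by auto
  have le: "g $ u \<le> g $ v" for u
    unfolding v[symmetric] M_def by (intro Max_ge) auto
  \<comment> \<open>Inserting \<open>M - 1\<close> keeps the set nonempty when \<open>g\<close> is
    constant.\<close>
  define S where "S = insert (M - 1) {x \<in> range (($) g). x < M}"
  have S: "finite S" "S \<noteq> {}" by (auto simp: S_def)
  have "Max S \<in> S" using S by (rule Max_in)
  then have "Max S < g $ v" by (auto simp: S_def v)
  moreover have "u \<in> argmax_set g" if "Max S < g $ u" for u
  proof -
    have "\<not> g $ u < M"
    proof
      assume "g $ u < M"
      then have "g $ u \<in> S" by (simp add: S_def)
      then show False using Max_ge[OF S(1)] that by fastforce
    qed
    then show ?thesis using le by (auto simp: argmax_set_def is_arg_max_def v not_less intro: order_trans)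
  qed
  ultimately show ?thesis using that le by blast
qed

section \<open>The maximum of \<open>g\<close> as a bound on the objective\<close>

lemma inner_le_max:
  assumes "q \<in> prob_simplex" "\<And>u. g $ u \<le> M"
  shows "g \<bullet> q \<le> M"
proof -
  have "g \<bullet> q \<le> (\<Sum>u\<in>UNIV. M * q $ u)"
    unfolding inner_vec_def inner_real_def
    using assms by (intro sum_mono mult_right_mono) (auto simp: prob_simplex_def)
  also have "\<dots> = M" using assms by (simp add: sum_distrib_left[symmetric] prob_simplex_def)
  finally show ?thesis .
qed

lemma inner_eq_max:
  assumes "q \<in> prob_simplex" "\<And>u. q $ u \<noteq> 0 \<Longrightarrow> g $ u = M"
  shows "g \<bullet> q = M"
proof -
  have "g \<bullet> q = (\<Sum>u\<in>UNIV. M * q $ u)"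
    unfolding inner_vec_def inner_real_def using assms(2) by (intro sum.cong) auto
  also have "\<dots> = M" using assms by (simp add: sum_distrib_left[symmetric] prob_simplex_def)
  finally show ?thesis .
qed

theorem theoremD6:
  fixes p g :: "real ^ 'u::finite" and \<epsilon> :: real
  assumes "p \<in> prob_simplex" and "\<forall>u. p $ u > 0" and "\<epsilon> > 0"
  shows "\<exists>\<delta> \<mu> qs. \<delta> \<ge> 0 \<and> optimal p g \<epsilon> qs
    \<and> (\<forall>u. qs $ u = p $ u * pos_part (1 + \<delta> * (g $ u + \<mu>)))
    \<and> (\<Sum>u\<in>UNIV. qs $ u) = 1
    \<and> (if \<exists>\<delta>'\<ge>0. \<exists>\<mu>'. (\<Sum>u\<in>UNIV. tilt p g \<delta>' \<mu>' $ u) = 1 \<and> chi_square p (tilt p g \<delta>' \<mu>') = \<epsilon>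
       then chi_square p qs = \<epsilon>
       else \<exists>q\<in>prob_simplex. (\<forall>u. q $ u \<noteq> 0 \<longrightarrow> u \<in> argmax_set g) \<and> chi_square p q \<le> \<epsilon>)"
proof (cases "\<exists>\<delta>'\<ge>0. \<exists>\<mu>'. (\<Sum>u\<in>UNIV. tilt p g \<delta>' \<mu>' $ u) = 1 \<and> chi_square p (tilt p g \<delta>' \<mu>') = \<epsilon>")
  case True
  then obtain \<delta> \<mu> where tilt: "\<delta> \<ge> 0" "(\<Sum>u\<in>UNIV. tilt p g \<delta> \<mu> $ u) = 1"
    "chi_square p (tilt p g \<delta> \<mu>) = \<epsilon>" by blast
  moreover have "optimal p g \<epsilon> (tilt p g \<delta> \<mu>)"
    using assms tilt by (rule tilt_optimal_if_tight)
  moreover have "\<forall>u. tilt p g \<delta> \<mu> $ u = p $ u * pos_part (1 + \<delta> * (g $ u + \<mu>))"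
    by (simp add: tilt_def)
  ultimately show ?thesis unfolding if_P[OF True] by blast
next
  case False
  obtain s v where v: "\<And>u. g $ u \<le> g $ v" and s: "s < g $ v"
    and sep: "\<And>u. s < g $ u \<Longrightarrow> u \<in> argmax_set g"
    by (rule exists_separating_level[of g]) (rule that)
  \<comment> \<open>All levels up to \<open>s\<close> are admissible, so the path used for
    continuity never meets a zero normaliser.\<close>
  have below: "t < g $ v" if "t \<le> s" for t using that s by linarith
  define \<delta> where "\<delta> t = 1 / excess p g t" for t
  define \<mu> where "\<mu> t = - t - excess p g t" for t
  have tilt: "level_tilt p g t = tilt p g (\<delta> t) (\<mu> t)" if "t \<le> s" for t
    unfolding \<delta>_def \<mu>_def using assms(2) below[OF that] by (rule level_tilt_eq_tilt)
  have \<delta>: "\<delta> t \<ge> 0" if "t \<le> s" for t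
    using excess_pos[of p t g v] assms(2) below[OF that] by (simp add: \<delta>_def)
  have norm: "(\<Sum>u\<in>UNIV. level_tilt p g t $ u) = 1" if "t \<le> s" for t
    using assms(2) below[OF that] by (rule sum_level_tilt)
  \<comment> \<open>This is \<open>p\<close> conditioned on the argmax set; it serves both as the
    optimal solution and as the feasible greedy distribution.\<close>
  define q where "q = level_tilt p g s"
  have simplex: "q \<in> prob_simplex"
    unfolding q_def tilt[OF order_refl]
    by (rule tilt_in_prob_simplex) (use assms norm[of s] tilt[of s] in auto)
  have support: "u \<in> argmax_set g" if "q $ u \<noteq> 0" for u
  proof (rule sep, rule ccontr)
    assume "\<not> s < g $ u"
    with that show False by (simp add: q_def level_tilt_def pos_part_def)
  qed
  \<comment> \<open>Otherwise the divergence would cross \<epsilon> between a feasible low level and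
    \<open>s\<close>, giving the tight tilt that this case excludes.\<close>
  have chi: "chi_square p q \<le> \<epsilon>"
  proof (rule ccontr)
    assume "\<not> chi_square p q \<le> \<epsilon>"
    then have gt: "\<epsilon> \<le> chi_square p (level_tilt p g s)" by (simp add: q_def)
    obtain t0 where t0: "t0 \<le> s" "chi_square p (level_tilt p g t0) \<le> \<epsilon>"
      using exists_level_tilt_feasible[OF assms] by blast
    have "continuous_on {t0..s} (\<lambda>t. chi_square p (level_tilt p g t))"
      using assms(2) below by (intro continuous_on_chi_square_level_tilt[of _ _ _ v]) auto
    from IVT'[OF t0(2) gt t0(1) this] obtain t
      where "t \<le> s" "chi_square p (level_tilt p g t) = \<epsilon>" by blast
    with \<delta>[of t] norm[of t] tilt[of t]
    have "\<delta> t \<ge> 0" "(\<Sum>u\<in>UNIV. tilt p g (\<delta> t) (\<mu> t) $ u) = 1"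
      "chi_square p (tilt p g (\<delta> t) (\<mu> t)) = \<epsilon>" by simp_all
    with False show False by blast
  qed
  have "optimal p g \<epsilon> q"
  proof (rule optimalI)
    show "q \<in> feasible p \<epsilon>" using simplex chi by (simp add: feasible_def)
    fix q' assume "q' \<in> feasible p \<epsilon>"
    then have "g \<bullet> q' \<le> g $ v" using v by (intro inner_le_max) (simp_all add: feasible_def)
    also have "g $ v = g \<bullet> q"
    proof (rule inner_eq_max[OF simplex, symmetric])
      fix u assume "q $ u \<noteq> 0"
      from support[OF this] v[of u] show "g $ u = g $ v"
        by (auto simp: argmax_set_def is_arg_max_def not_less intro: antisym)
    qed
    finally show "g \<bullet> q' \<le> g \<bullet> q" .
  qed
  moreover have "\<forall>u. q $ u = p $ u * pos_part (1 + \<delta> s * (g $ u + \<mu> s))"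
    unfolding q_def tilt[OF order_refl] by (simp add: tilt_def)
  moreover have "(\<Sum>u\<in>UNIV. q $ u) = 1" "\<delta> s \<ge> 0"
    using norm \<delta> by (auto simp: q_def)
  ultimately show ?thesis unfolding if_not_P[OF False] using simplex support chi by blast
qed

end
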